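(* Let $N\ge 1$, let $\theta=(\theta_1,\dots,\theta_N)\in\mathbb{T}^N=(\mathbb{R}/2\pi\mathbb{Z})^N$, and let $J=J(\theta)$ and $D=D(\theta)$ be the Jacobian matrix of the Kuramoto vector field and its associated diagonal matrix $D_{ii}=\sum_{k}\cos(\theta_k-\theta_i)$. Suppose that $D$ is invertible, and define $$\tau=\sum_{i=1}^N\frac{1}{\sum_{j=1}^N\cos(\theta_j-\theta_i)}=\langle v,D^{-1}v\rangle+\langle w,D^{-1}w\rangle=\langle \mathbf 1,D^{-1}\mathbf 1\rangle .$$ Then $$n_+(J)=n_+(-D)+\begin{cases}0,&\tau<2,\\ 1,&\tau>2.\end{cases}$$
   Context: For $\theta\in\mathbb{T}^N$ let $f_i(\theta)=\sum_{j=1}^N\sin(\theta_j-\theta_i)$, $i=1,\dots,N$. The Jacobian is $J_{ij}(\theta)=\partial f_i/\partial\theta_j$, i.e. $J_{ij}=\cos(\theta_i-\theta_j)$ for $i\ne j$ and $J_{ii}=-\sum_{k\neq i}\cos(\theta_k-\theta_i)$. $D$ is the diagonal matrix with $D_{ii}=\sum_{k=1}^N\cos(\theta_k-\theta_i)$ (the sum includes $k=i$). Set $v=(\sin\theta_1,\dots,\sin\theta_N)^t$, $w=(\cos\theta_1,\dots,\cos\theta_N)^t$, $\mathbf 1=(1,\dots,1)^t$; $\langle\cdot,\cdot\rangle$ is the Euclidean inner product. One has $J=-D+v v^t+w w^t$. For a square matrix $A$, $n_+(A)$ denotes the number of eigenvalues of $A$ with positive real part (counted with multiplicity). *)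

theory Defs
  imports
    "HOL-Analysis.Derivative"
    "Jordan_Normal_Form.Gauss_Jordan_Elimination"
    "Jordan_Normal_Form.Char_Poly"
begin

unbundle no vec_syntax and no inner_syntax

text \<open>
  A point of the torus is represented by a vector of real lifts, with coordinates indexed by
  \<open>0, \<dots>, N - 1\<close> where \<open>N = dim_vec \<theta>\<close>. The lemmas \<open>kuramoto_jacobian_torus\<close>,
  \<open>kuramoto_diag_torus\<close>, \<open>kuramoto_tau_torus\<close>, \<open>sin_vec_torus\<close> and \<open>cos_vec_torus\<close> show that
  nothing depends on the choice of the lifts.
\<close>

definition kuramoto_field :: "real Matrix.vec \<Rightarrow> real Matrix.vec" where
  "kuramoto_field \<theta> = Matrix.vec (dim_vec \<theta>) (\<lambda>i. \<Sum>j<dim_vec \<theta>. sin (\<theta> $ j - \<theta> $ i))"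

text \<open>
  The entry \<open>(i, j)\<close> is the partial derivative of the \<open>i\<close>-th component in the \<open>j\<close>-th coordinate
  direction; \<open>kuramoto_jacobian_index\<close> and \<open>kuramoto_field_has_partial_derivative\<close> show that this
  derivative exists and give its value.
\<close>

definition kuramoto_jacobian :: "real Matrix.vec \<Rightarrow> real mat" where
  "kuramoto_jacobian \<theta> = Matrix.mat (dim_vec \<theta>) (dim_vec \<theta>)
     (\<lambda>(i, j). deriv (\<lambda>t. kuramoto_field (\<theta> + t \<cdot>\<^sub>v unit_vec (dim_vec \<theta>) j) $ i) 0)"

definition kuramoto_diag :: "real Matrix.vec \<Rightarrow> real mat" where
  "kuramoto_diag \<theta> = Matrix.mat (dim_vec \<theta>) (dim_vec \<theta>)
     (\<lambda>(i, j). if i = j then \<Sum>k<dim_vec \<theta>. cos (\<theta> $ k - \<theta> $ i) else 0)"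

definition sin_vec :: "real Matrix.vec \<Rightarrow> real Matrix.vec" where
  "sin_vec \<theta> = map_vec sin \<theta>"

definition cos_vec :: "real Matrix.vec \<Rightarrow> real Matrix.vec" where
  "cos_vec \<theta> = map_vec cos \<theta>"

definition ones_vec :: "nat \<Rightarrow> real Matrix.vec" where
  "ones_vec N = Matrix.vec N (\<lambda>_. 1)"

definition kuramoto_tau :: "real Matrix.vec \<Rightarrow> real" where
  "kuramoto_tau \<theta> = (\<Sum>i<dim_vec \<theta>. 1 / (\<Sum>j<dim_vec \<theta>. cos (\<theta> $ j - \<theta> $ i)))"

text \<open>
  Eigenvalues are taken over the complex numbers and counted with algebraic multiplicity. For a
  square matrix the index set is finite by \<open>finite_eigenvalues\<close>, so the sum is the actual count.
\<close>

definition n_plus :: "complex mat \<Rightarrow> nat" where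
  "n_plus A = (\<Sum>z | eigenvalue A z \<and> Re z > 0. Polynomial.order z (char_poly A))"

lemma finite_eigenvalues:
  fixes A :: "complex mat"
  assumes "A \<in> carrier_mat n n"
  shows "finite {z. eigenvalue A z \<and> Re z > 0}"
proof -
  have "char_poly A \<noteq> 0"
    using degree_monic_char_poly[OF assms] by auto
  then have "finite {z. poly (char_poly A) z = 0}"
    by (rule poly_roots_finite)
  then show ?thesis
    by (rule rev_finite_subset) (auto simp: eigenvalue_root_char_poly[OF assms])
qed

lemma kuramoto_field_has_partial_derivative:
  assumes i: "i < dim_vec \<theta>" and j: "j < dim_vec \<theta>"
  shows "((\<lambda>t. kuramoto_field (\<theta> + t \<cdot>\<^sub>v unit_vec (dim_vec \<theta>) j) $ i) has_real_derivative
    (if i = j then - (\<Sum>k\<in>{..<dim_vec \<theta>} - {i}. cos (\<theta> $ k - \<theta> $ i))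
     else cos (\<theta> $ i - \<theta> $ j))) (at 0)"
proof -
  let ?N = "dim_vec \<theta>"
  let ?e = "\<lambda>k. if k = j then 1 else 0 :: real"
  have eq: "kuramoto_field (\<theta> + t \<cdot>\<^sub>v unit_vec ?N j) $ i
      = (\<Sum>k<?N. sin ((\<theta> $ k + t * ?e k) - (\<theta> $ i + t * ?e i)))" for t
    using i j by (auto simp: kuramoto_field_def unit_vec_def intro!: sum.cong)
  have "((\<lambda>t. \<Sum>k<?N. sin ((\<theta> $ k + t * ?e k) - (\<theta> $ i + t * ?e i))) has_real_derivative
      (\<Sum>k<?N. cos (\<theta> $ k - \<theta> $ i) * (?e k - ?e i))) (at 0)"
    by (auto intro!: derivative_eq_intros sum.cong)
  moreover have "(\<Sum>k<?N. cos (\<theta> $ k - \<theta> $ i) * (?e k - ?e i))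
      = (if i = j then - (\<Sum>k\<in>{..<?N} - {i}. cos (\<theta> $ k - \<theta> $ i)) else cos (\<theta> $ i - \<theta> $ j))"
  proof (cases "i = j")
    case True
    have "(\<Sum>k<?N. cos (\<theta> $ k - \<theta> $ i) * (?e k - ?e i))
        = (\<Sum>k\<in>{..<?N} - {i}. cos (\<theta> $ k - \<theta> $ i) * (?e k - ?e i))"
      using i True by (intro sum.mono_neutral_right) auto
    also have "\<dots> = (\<Sum>k\<in>{..<?N} - {i}. - cos (\<theta> $ k - \<theta> $ i))"
      using True by (intro sum.cong) auto
    finally show ?thesis using True by (simp add: sum_negf)
  next
    case False
    then have "(\<Sum>k<?N. cos (\<theta> $ k - \<theta> $ i) * (?e k - ?e i))
        = (\<Sum>k<?N. if k = j then cos (\<theta> $ j - \<theta> $ i) else 0)"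
      by (intro sum.cong) auto
    also have "\<dots> = cos (\<theta> $ i - \<theta> $ j)"
      using j by (simp add: cos_diff mult.commute)
    finally show ?thesis using False by simp
  qed
  ultimately show ?thesis
    unfolding eq by simp
qed

lemma kuramoto_jacobian_index:
  assumes "i < dim_vec \<theta>" and "j < dim_vec \<theta>"
  shows "kuramoto_jacobian \<theta> $$ (i, j) =
    (if i = j then - (\<Sum>k\<in>{..<dim_vec \<theta>} - {i}. cos (\<theta> $ k - \<theta> $ i))
     else cos (\<theta> $ i - \<theta> $ j))"
  using assms DERIV_imp_deriv[OF kuramoto_field_has_partial_derivative[OF assms]]
  by (simp add: kuramoto_jacobian_def)

definition same_torus_point :: "real Matrix.vec \<Rightarrow> real Matrix.vec \<Rightarrow> bool" where
  "same_torus_point \<theta> \<phi> \<longleftrightarrow>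
     dim_vec \<theta> = dim_vec \<phi> \<and> (\<forall>i<dim_vec \<theta>. \<exists>m::int. \<theta> $ i = \<phi> $ i + 2 * pi * of_int m)"

lemma cos_diff_torus:
  assumes "same_torus_point \<theta> \<phi>" "i < dim_vec \<phi>" "j < dim_vec \<phi>"
  shows "cos (\<theta> $ i - \<theta> $ j) = cos (\<phi> $ i - \<phi> $ j)"
proof -
  obtain m n :: int where "\<theta> $ i = \<phi> $ i + 2 * pi * m" "\<theta> $ j = \<phi> $ j + 2 * pi * n"
    using assms unfolding same_torus_point_def by metis
  then have "\<theta> $ i - \<theta> $ j = (\<phi> $ i - \<phi> $ j) + 2 * pi * of_int (m - n)"
    by (simp add: algebra_simps)
  moreover have "cos (x + 2 * pi * of_int k) = cos x" for x and k :: int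
    by (simp only: cos_add sin_int_2pin cos_int_2pin mult_1_right mult_zero_right diff_zero)
  ultimately show ?thesis
    by metis
qed

lemma kuramoto_jacobian_torus:
  assumes "same_torus_point \<theta> \<phi>"
  shows "kuramoto_jacobian \<theta> = kuramoto_jacobian \<phi>"
proof -
  have N: "dim_vec \<theta> = dim_vec \<phi>"
    using assms by (simp add: same_torus_point_def)
  show ?thesis
  proof (rule eq_matI)
    fix i j assume "i < dim_row (kuramoto_jacobian \<phi>)" "j < dim_col (kuramoto_jacobian \<phi>)"
    then have ij: "i < dim_vec \<phi>" "j < dim_vec \<phi>"
      by (simp_all add: kuramoto_jacobian_def)
    have "(\<Sum>k\<in>{..<dim_vec \<phi>} - {i}. cos (\<theta> $ k - \<theta> $ i))
        = (\<Sum>k\<in>{..<dim_vec \<phi>} - {i}. cos (\<phi> $ k - \<phi> $ i))"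
      using ij by (intro sum.cong refl cos_diff_torus[OF assms]) auto
    then show "kuramoto_jacobian \<theta> $$ (i, j) = kuramoto_jacobian \<phi> $$ (i, j)"
      using ij N cos_diff_torus[OF assms] by (simp add: kuramoto_jacobian_index)
  qed (simp_all add: kuramoto_jacobian_def N)
qed

lemma kuramoto_diag_torus:
  assumes "same_torus_point \<theta> \<phi>"
  shows "kuramoto_diag \<theta> = kuramoto_diag \<phi>"
proof -
  have N: "dim_vec \<theta> = dim_vec \<phi>"
    using assms by (simp add: same_torus_point_def)
  show ?thesis
    by (rule eq_matI)
      (auto simp: kuramoto_diag_def N intro!: sum.cong cos_diff_torus[OF assms])
qed

lemma kuramoto_tau_torus:
  assumes "same_torus_point \<theta> \<phi>"
  shows "kuramoto_tau \<theta> = kuramoto_tau \<phi>"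
proof -
  have N: "dim_vec \<theta> = dim_vec \<phi>"
    using assms by (simp add: same_torus_point_def)
  show ?thesis
    unfolding kuramoto_tau_def N
    by (intro sum.cong refl arg_cong2[where f = "(/)"] cos_diff_torus[OF assms]) auto
qed

lemma sin_vec_torus:
  assumes "same_torus_point \<theta> \<phi>"
  shows "sin_vec \<theta> = sin_vec \<phi>"
proof (rule eq_vecI)
  fix i assume "i < dim_vec (sin_vec \<phi>)"
  moreover from this obtain m :: int where "\<theta> $ i = \<phi> $ i + 2 * pi * m"
    using assms unfolding same_torus_point_def sin_vec_def by auto
  ultimately show "sin_vec \<theta> $ i = sin_vec \<phi> $ i"
    using assms by (simp add: sin_vec_def same_torus_point_def sin_add)
qed (use assms in \<open>simp add: sin_vec_def same_torus_point_def\<close>)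

lemma cos_vec_torus:
  assumes "same_torus_point \<theta> \<phi>"
  shows "cos_vec \<theta> = cos_vec \<phi>"
proof (rule eq_vecI)
  fix i assume "i < dim_vec (cos_vec \<phi>)"
  moreover from this obtain m :: int where "\<theta> $ i = \<phi> $ i + 2 * pi * m"
    using assms unfolding same_torus_point_def cos_vec_def by auto
  ultimately show "cos_vec \<theta> $ i = cos_vec \<phi> $ i"
    using assms by (simp add: cos_vec_def same_torus_point_def cos_add)
qed (use assms in \<open>simp add: cos_vec_def same_torus_point_def\<close>)

end

theory Submission
  imports Defs "Jordan_Normal_Form.Schur_Decomposition"
begin

text \<open>
  Let \<open>\<Sum>\<^sub>k exp(i \<theta>\<^sub>k) = R exp(i \<phi>)\<close>, \<open>\<psi>\<^sub>k = \<theta>\<^sub>k - \<phi>\<close>, and let \<open>U\<close> have the columns \<open>cos \<psi>\<close> and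
  \<open>sin \<psi>\<close>. Then \<open>D\<close> has the diagonal entries \<open>R cos \<psi>\<^sub>k\<close>, \<open>J = -D + U U\<^sup>T\<close>, and, since
  \<open>\<Sum>\<^sub>k cos \<psi>\<^sub>k = R\<close> and \<open>\<Sum>\<^sub>k sin \<psi>\<^sub>k = 0\<close>, the matrix \<open>U\<^sup>T D\<^sup>-\<^sup>1 U\<close> is \<open>diag(1, \<tau> - 1)\<close>. Taking Schur
  complements of the symmetric block matrix with diagonal blocks \<open>-D\<close>, \<open>-1\<close> and off-diagonal block
  \<open>-U\<close> in both ways, Sylvester's law of inertia gives
  \<open>n\<^sub>+(J) + n\<^sub>+(-1) = n\<^sub>+(-D) + n\<^sub>+(U\<^sup>T D\<^sup>-\<^sup>1 U - 1)\<close>, and the last matrix is \<open>diag(0, \<tau> - 2)\<close>.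
\<close>

section \<open>Counting eigenvalues with positive real part\<close>

lemma order_prod_linear_factors:
  "Polynomial.order z (\<Prod>e\<leftarrow>es. [:- e, 1:]) = count_list es (z :: complex)"
proof (induction es)
  case (Cons e es)
  have "(\<Prod>e\<leftarrow>es. [:- e, 1:]) \<noteq> 0"
    by (induction es) (simp_all add: pCons_eq_0_iff del: mult_pCons_left)
  then have "Polynomial.order z ([:- e, 1:] * (\<Prod>e\<leftarrow>es. [:- e, 1:]))
      = Polynomial.order z [:- e, 1:] + Polynomial.order z (\<Prod>e\<leftarrow>es. [:- e, 1:])"
    by (intro order_mult) (simp del: mult_pCons_left add: pCons_eq_0_iff)
  then show ?case
    using Cons order_linear'[of z "- e"] by (auto simp del: mult_pCons_left)
qed (simp add: order_0I)

text \<open>The order of a root is its number of occurrences in the list of linear factors, so the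
  weighted count becomes a list length. Block sums then correspond to appending lists.\<close>

lemma n_plus_factored:
  assumes A: "A \<in> carrier_mat n n"
    and es: "char_poly A = (\<Prod>e\<leftarrow>es. [:- e, 1:])"
  shows "n_plus A = length (filter (\<lambda>z. Re z > 0) es)"
proof -
  let ?fs = "filter (\<lambda>z. Re z > 0) es"
  have ev: "{z. eigenvalue A z \<and> Re z > 0} = set ?fs"
    unfolding eigenvalue_root_char_poly[OF A] es
    by (auto simp: poly_prod_list prod_list_zero_iff)
  have "n_plus A = (\<Sum>z\<in>set ?fs. count_list ?fs z)"
    unfolding n_plus_def ev es order_prod_linear_factors
    by (intro sum.cong refl) (auto simp: count_list_eq_length_filter conj_commute intro!: arg_cong[where f=length] filter_cong)
  then show ?thesis
    by (simp add: sum_count_set)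
qed

lemma n_plus_four_block_diag:
  assumes A: "A \<in> carrier_mat n n" and B: "B \<in> carrier_mat m m"
  shows "n_plus (four_block_mat A (0\<^sub>m n m) (0\<^sub>m m n) B) = n_plus A + n_plus B"
proof -
  obtain as where as: "char_poly A = (\<Prod>e\<leftarrow>as. [:- e, 1:])"
    using char_poly_factorized[OF A] by blast
  obtain bs where bs: "char_poly B = (\<Prod>e\<leftarrow>bs. [:- e, 1:])"
    using char_poly_factorized[OF B] by blast
  have "char_poly (four_block_mat A (0\<^sub>m n m) (0\<^sub>m m n) B) = char_poly A * char_poly B"
    using as bs by (intro char_poly_0_block[OF refl _ _ A _ B]) auto
  also have "\<dots> = (\<Prod>e\<leftarrow>as @ bs. [:- e, 1:])"
    using as bs by simp
  finally show ?thesis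
    using n_plus_factored[OF A as] n_plus_factored[OF B bs]
      n_plus_factored[OF four_block_carrier_mat[OF A B], of _ _ "as @ bs"] by simp
qed

lemma n_plus_diagonal:
  "n_plus (map_mat complex_of_real (Matrix.mat n n (\<lambda>(i, j). if i = j then d i else 0)))
     = length (filter (\<lambda>i. d i > 0) [0..<n])" (is "n_plus ?D = _")
proof -
  have D: "?D \<in> carrier_mat n n" by simp
  have "char_poly ?D = (\<Prod>e\<leftarrow>diag_mat ?D. [:- e, 1:])"
    by (rule char_poly_upper_triangular[OF D]) (auto simp: upper_triangular_def)
  also have "diag_mat ?D = map (\<lambda>i. complex_of_real (d i)) [0..<n]"
    by (auto simp: diag_mat_def)
  finally have "char_poly ?D = (\<Prod>e\<leftarrow>map (\<lambda>i. complex_of_real (d i)) [0..<n]. [:- e, 1:])" .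
  from n_plus_factored[OF D this] show ?thesis
    by (simp add: filter_map o_def)
qed

text \<open>\<open>n_plus\<close> depends only on the characteristic polynomial: eigenvalues are its
  roots, weighted by their orders.\<close>

lemma n_plus_of_real_similar:
  assumes "similar_mat A (B :: real mat)"
  shows "n_plus (map_mat complex_of_real A) = n_plus (map_mat complex_of_real B)"
proof -
  obtain n where "A \<in> carrier_mat n n" "B \<in> carrier_mat n n"
    using similar_matD[OF assms] by auto
  moreover from this have "char_poly (map_mat complex_of_real A) = char_poly (map_mat complex_of_real B)"
    using char_poly_similar[OF assms] by (simp add: of_real_hom.char_poly_hom)
  ultimately show ?thesis
    by (simp add: n_plus_def eigenvalue_root_char_poly[of _ n])
qed

section \<open>Orthogonal diagonalization of real symmetric matrices\<close>

text \<open>A complex eigenvector \<open>x\<close> exists because the characteristic polynomial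
  splits. Evaluating the Hermitian form of \<open>A\<close> at \<open>x\<close> in two ways gives
  \<open>z = cnj z\<close>, so \<open>z\<close> is a real root of the characteristic
  polynomial.\<close>

lemma real_symmetric_eigenvalue:
  assumes A: "A \<in> carrier_mat n n" and sym: "A\<^sup>T = A" and n: "n > 0"
  obtains e :: real where "eigenvalue A e"
proof -
  let ?A = "map_mat complex_of_real A"
  have cA: "?A \<in> carrier_mat n n" using A by simp
  obtain es where es: "char_poly ?A = (\<Prod>e\<leftarrow>es. [:- e, 1:])" "length es = n"
    using char_poly_factorized[OF cA] by blast
  then obtain z where "z \<in> set es" using n by (cases es) auto
  then have "eigenvalue ?A z"
    unfolding eigenvalue_root_char_poly[OF cA] es
    by (auto simp: poly_prod_list prod_list_zero_iff)
  then obtain x where x: "x \<in> carrier_vec n" "x \<noteq> 0\<^sub>v n" "?A *\<^sub>v x = z \<cdot>\<^sub>v x"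
    unfolding eigenvalue_def eigenvector_def using cA by auto
  let ?x = "map_vec cnj x"
  have cx: "?x \<in> carrier_vec n" using x by simp
  \<comment> \<open>Conjugation commutes with \<open>?A\<close> because its entries are
    real.\<close>
  have Ax: "?A *\<^sub>v ?x = map_vec cnj (?A *\<^sub>v x)"
    using A x(1) by (intro eq_vecI) (auto simp: scalar_prod_def)
  have "z * (?x \<bullet> x) = ?x \<bullet> (?A *\<^sub>v x)"
    using x by simp
  also have "\<dots> = (?A *\<^sub>v ?x) \<bullet> x"
    using transpose_vec_mult_scalar[OF cA x(1) cx] sym
    by (simp add: map_mat_transpose)
  also have "\<dots> = cnj z * (?x \<bullet> x)"
    unfolding Ax x(3) using x by (simp add: scalar_prod_def sum_distrib_left mult.assoc)
  finally have eq: "z * (?x \<bullet> x) = cnj z * (?x \<bullet> x)" .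
  have "?x \<bullet> x = complex_of_real (\<Sum>i<n. (cmod (x $ i))\<^sup>2)"
    using x by (simp add: scalar_prod_def complex_norm_square mult.commute atLeast0LessThan del: of_real_power)
  moreover have "(\<Sum>i<n. (cmod (x $ i))\<^sup>2) \<noteq> 0"
  proof
    assume "(\<Sum>i<n. (cmod (x $ i))\<^sup>2) = 0"
    then have "\<forall>i<n. x $ i = 0"
      by (subst (asm) sum_nonneg_eq_0_iff) auto
    then show False using x by (auto intro: eq_vecI)
  qed
  ultimately have "?x \<bullet> x \<noteq> 0" by (metis of_real_eq_0_iff)
  then have "z = cnj z" using eq by simp
  then have z: "z = complex_of_real (Re z)"
    by (simp add: complex_eq_iff)
  have "poly (char_poly ?A) z = 0"
    using \<open>eigenvalue ?A z\<close> eigenvalue_root_char_poly[OF cA] by simp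
  then have "poly (map_poly complex_of_real (char_poly A)) (complex_of_real (Re z)) = 0"
    using z of_real_hom.char_poly_hom[OF A] by metis
  then have "poly (char_poly A) (Re z) = 0"
    by (simp only: of_real_hom.poly_map_poly of_real_eq_0_iff)
  then have "eigenvalue A (Re z)"
    by (simp add: eigenvalue_root_char_poly[OF A])
  then show thesis by (rule that)
qed

text \<open>Complete \<open>v\<close> to a basis and apply Gram-Schmidt, which keeps the first
  vector. Dividing by lengths makes the columns orthonormal, so \<open>c\<close> comes out as the
  reciprocal of the length of \<open>v\<close>.\<close>

lemma orthogonal_matrix_with_first_column:
  fixes v :: "real Matrix.vec"
  assumes v: "v \<in> carrier_vec n" and v0: "v \<noteq> 0\<^sub>v n"
  obtains W c where "W \<in> carrier_mat n n" "W\<^sup>T * W = 1\<^sub>m n" "col W 0 = c \<cdot>\<^sub>v v"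
proof -
  interpret cof_vec_space n "TYPE(real)" .
  define b where "b = basis_completion v"
  define ws where "ws = gram_schmidt n b"
  note bc = basis_completion[OF v v0, folded b_def]
  have n: "n > 0" using v v0 by (cases n) auto
  obtain vs where b: "b = v # vs" using bc(6,7) n by (cases b) auto
  have ws: "corthogonal ws" "set ws \<subseteq> carrier_vec n" "length ws = n"
    using gram_schmidt_result[OF bc(2,4,5) ws_def] bc(6) by auto
  have hd: "ws ! 0 = v"
    using gram_schmidt_hd[OF v, of vs] ws(3) n unfolding ws_def b by (metis hd_conv_nth length_greater_0_conv)
  define r where "r j = sqrt (ws ! j \<bullet> ws ! j)" for j
  define W where "W = Matrix.mat n n (\<lambda>(i, j). ws ! j $ i / r j)"
  have W: "W \<in> carrier_mat n n" by (simp add: W_def)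
  have wsj: "ws ! j \<in> carrier_vec n" if "j < n" for j
    using ws that by auto
  have orth: "ws ! i \<bullet> ws ! j = 0 \<longleftrightarrow> i \<noteq> j" if "i < n" "j < n" for i j
  proof -
    \<comment> \<open>\<open>corthogonal\<close> involves a conjugation, which is trivial over the
      reals.\<close>
    have "conjugate (ws ! j) = ws ! j" by (auto intro: eq_vecI)
    then show ?thesis using corthogonalD[OF ws(1)] that ws(3) by metis
  qed
  have pos: "ws ! j \<bullet> ws ! j > 0" if "j < n" for j
  proof -
    have "ws ! j \<bullet> ws ! j \<ge> 0" by (auto simp: scalar_prod_def intro: sum_nonneg)
    then show ?thesis using orth[OF that that] by simp
  qed
  have "W\<^sup>T * W = 1\<^sub>m n"
  proof (rule eq_matI)
    fix i j assume "i < dim_row (1\<^sub>m n :: real mat)" "j < dim_col (1\<^sub>m n :: real mat)"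
    then have ij: "i < n" "j < n" by auto
    have "(W\<^sup>T * W) $$ (i, j) = (\<Sum>k<n. ws ! i $ k / r i * (ws ! j $ k / r j))"
      using ij by (simp add: W_def scalar_prod_def atLeast0LessThan)
    also have "\<dots> = (ws ! i \<bullet> ws ! j) / (r i * r j)"
      using wsj[OF ij(2)] by (simp add: scalar_prod_def sum_divide_distrib atLeast0LessThan)
    also have "\<dots> = 1\<^sub>m n $$ (i, j)"
      using ij orth[OF ij] pos[OF ij(1)] by (auto simp: r_def)
    finally show "(W\<^sup>T * W) $$ (i, j) = 1\<^sub>m n $$ (i, j)" .
  qed (auto simp: W_def)
  moreover have "col W 0 = (1 / r 0) \<cdot>\<^sub>v v"
    using n v hd by (intro eq_vecI) (auto simp: W_def)
  ultimately show thesis using W that by blast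
qed

text \<open>Deflation: an orthogonal change of basis whose first column is an eigenvector splits off
  a 1 by 1 block, and induction handles the remaining symmetric block. Since the inverse of
  \<open>U\<close> is its transpose, the result is both a similarity and a congruence.\<close>

lemma real_symmetric_diagonalization:
  fixes A :: "real mat"
  assumes "A \<in> carrier_mat n n" and "A\<^sup>T = A"
  shows "\<exists>U d. U \<in> carrier_mat n n \<and> U\<^sup>T * U = 1\<^sub>m n
    \<and> U\<^sup>T * A * U = Matrix.mat n n (\<lambda>(i, j). if i = j then d i else 0)"
  using assms
proof (induction n arbitrary: A)
  case 0
  then show ?case by (intro exI[of _ "1\<^sub>m 0"] exI) auto
next
  case (Suc n)
  note A = Suc.prems(1) and sym = Suc.prems(2)
  obtain e where "eigenvalue A e"
    using real_symmetric_eigenvalue[OF A sym] by auto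
  then obtain v where v: "v \<in> carrier_vec (Suc n)" "v \<noteq> 0\<^sub>v (Suc n)" "A *\<^sub>v v = e \<cdot>\<^sub>v v"
    unfolding eigenvalue_def eigenvector_def using A by auto
  obtain W c where W: "W \<in> carrier_mat (Suc n) (Suc n)" "W\<^sup>T * W = 1\<^sub>m (Suc n)"
    and col0: "col W 0 = c \<cdot>\<^sub>v v"
    using orthogonal_matrix_with_first_column[OF v(1,2)] by blast
  define B where "B = W\<^sup>T * A * W"
  have B: "B \<in> carrier_mat (Suc n) (Suc n)"
    using W A by (simp add: B_def)
  have symB: "B\<^sup>T = B"
    unfolding B_def using W(1) A sym
    by (simp add: transpose_mult[of _ "Suc n" "Suc n" _ "Suc n"])
  \<comment> \<open>The first column of \<open>W\<close> is an eigenvector, so that of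
    \<open>B\<close> is \<open>e\<close> times the first column of \<open>W\<^sup>T * W\<close>, the
    identity.\<close>
  have B0: "B $$ (i, 0) = (if i = 0 then e else 0)" if i: "i < Suc n" for i
  proof -
    have "B = W\<^sup>T * (A * W)"
      unfolding B_def using W(1) A by simp
    then have "B $$ (i, 0) = col W i \<bullet> (A *\<^sub>v col W 0)"
      using W(1) A i by (simp add: mult_mat_vec_def)
    also have "A *\<^sub>v col W 0 = e \<cdot>\<^sub>v col W 0"
      unfolding col0 using A v by (simp add: mult_mat_vec smult_smult_assoc mult.commute)
    also have "col W i \<bullet> (e \<cdot>\<^sub>v col W 0) = e * (W\<^sup>T * W) $$ (i, 0)"
      using W(1) i by simp
    finally show ?thesis
      using i unfolding W(2) by simp
  qed
  define B' where "B' = Matrix.mat n n (\<lambda>(i, j). B $$ (Suc i, Suc j))"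
  have B': "B' \<in> carrier_mat n n" by (simp add: B'_def)
  have symBij: "B $$ (i, j) = B $$ (j, i)" if "i < Suc n" "j < Suc n" for i j
    using symB B that by (metis carrier_matD index_transpose_mat(1))
  have "B'\<^sup>T = B'"
    by (rule eq_matI) (auto simp: B'_def intro: symBij)
  then obtain U d where U: "U \<in> carrier_mat n n" "U\<^sup>T * U = 1\<^sub>m n"
    "U\<^sup>T * B' * U = Matrix.mat n n (\<lambda>(i, j). if i = j then d i else 0)"
    using Suc.IH[OF B'] by blast
  define E where "E = Matrix.mat 1 1 (\<lambda>_. e)"
  have E: "E \<in> carrier_mat 1 1" by (simp add: E_def)
  let ?Z = "0\<^sub>m 1 n" and ?Z' = "0\<^sub>m n 1"
  \<comment> \<open>\<open>B0\<close> determines the first column; symmetry transfers its zeros to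
    the first row.\<close>
  have Bblock: "B = four_block_mat E ?Z ?Z' B'"
  proof (rule eq_matI)
    fix i j
    assume "i < dim_row (four_block_mat E ?Z ?Z' B')" "j < dim_col (four_block_mat E ?Z ?Z' B')"
    then have ij: "i < Suc n" "j < Suc n" using E B' by auto
    show "B $$ (i, j) = four_block_mat E ?Z ?Z' B' $$ (i, j)"
      using ij E B' B0[OF ij(1)] B0[OF ij(2)] symBij[OF ij]
      by (cases i; cases j) (auto simp: E_def B'_def)
  qed (use B E B' in auto)
  \<comment> \<open>\<open>V\<close> fixes the split-off coordinate and acts as \<open>U\<close> on
    the others; the diagonalizing matrix is \<open>W * V\<close>.\<close>
  define V where "V = four_block_mat (1\<^sub>m 1) ?Z ?Z' U"
  have V: "V \<in> carrier_mat (Suc n) (Suc n)"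
    using U four_block_carrier_mat[of "1\<^sub>m 1" 1 1 U n n] by (simp add: V_def)
  have VT: "V\<^sup>T = four_block_mat (1\<^sub>m 1) ?Z ?Z' (U\<^sup>T)"
    unfolding V_def using U(1)
    by (subst transpose_four_block_mat[of _ 1 1 _ n _ n]) auto
  have VV: "V\<^sup>T * V = 1\<^sub>m (Suc n)"
    unfolding VT unfolding V_def using U
    by (subst mult_four_block_mat[of _ 1 1 _ n _ n _ _ 1 _ n])
      (auto simp: four_block_one_mat[of 1 n, simplified])
  have UTB: "U\<^sup>T * B' \<in> carrier_mat n n" using U(1) B' by simp
  have "V\<^sup>T * B = four_block_mat E ?Z ?Z' (U\<^sup>T * B')"
    unfolding VT Bblock using U(1) B' E
    by (subst mult_four_block_mat[of _ 1 1 _ n _ n _ _ 1 _ n]) auto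
  then have VBV: "V\<^sup>T * B * V = four_block_mat E ?Z ?Z' (U\<^sup>T * B' * U)"
    unfolding V_def using U(1) B' E UTB
    by (simp, subst mult_four_block_mat[of _ 1 1 _ n _ n _ _ 1 _ n]) auto
  have WV: "W * V \<in> carrier_mat (Suc n) (Suc n)" using W V by simp
  have T: "(W * V)\<^sup>T = V\<^sup>T * W\<^sup>T"
    using W(1) V by (rule transpose_mult)
  have carrT: "W\<^sup>T \<in> carrier_mat (Suc n) (Suc n)" "V\<^sup>T \<in> carrier_mat (Suc n) (Suc n)"
    using W V by auto
  have "(W * V)\<^sup>T * (W * V) = V\<^sup>T * (W\<^sup>T * W) * V"
    unfolding T using W(1) V carrT
    by (simp add: assoc_mult_mat[of _ "Suc n" "Suc n" _ "Suc n" _ "Suc n"])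
  then have one: "(W * V)\<^sup>T * (W * V) = 1\<^sub>m (Suc n)"
    unfolding W(2) using VV V carrT by simp
  have "(W * V)\<^sup>T * A * (W * V) = V\<^sup>T * B * V"
    unfolding T B_def using W(1) V A carrT
    by (simp add: assoc_mult_mat[of _ "Suc n" "Suc n" _ "Suc n" _ "Suc n"])
  \<comment> \<open>The eigenvalue \<open>e\<close> takes index 0 and the values of \<open>d\<close>
    move up by one, hence \<open>case_nat\<close>.\<close>
  also have "\<dots> = Matrix.mat (Suc n) (Suc n) (\<lambda>(i, j). if i = j then case_nat e d i else 0)"
    unfolding VBV U(3)
    by (rule eq_matI) (use E in \<open>auto simp: E_def split: nat.split\<close>)
  finally show ?case using one WV by blast
qed

section \<open>Sylvester's law of inertia\<close>

text \<open>As rows of a square matrix the vectors leave room for a zero row, so the determinant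
  vanishes and the kernel is nontrivial.\<close>

lemma exists_nonzero_orthogonal_vec:
  fixes vs :: "'a :: idom Matrix.vec list"
  assumes vs: "set vs \<subseteq> carrier_vec n" and len: "length vs < n"
  obtains x where "x \<in> carrier_vec n" "x \<noteq> 0\<^sub>v n" "\<And>v. v \<in> set vs \<Longrightarrow> v \<bullet> x = 0"
proof -
  let ?f = "\<lambda>i. if i < length vs then vs ! i else 0\<^sub>v n"
  \<comment> \<open>The explicit test for the zero row \<open>length vs\<close> gives the form
    expected by \<open>det_row_0\<close>.\<close>
  define M where "M = mat\<^sub>r n n (\<lambda>i. if i = length vs then 0\<^sub>v n else ?f i)"
  have M: "M \<in> carrier_mat n n" by (simp add: M_def)
  have "det M = 0"
    unfolding M_def using vs by (intro det_row_0[OF len]) (auto simp: subset_iff)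
  then obtain x where x: "x \<in> carrier_vec n" "x \<noteq> 0\<^sub>v n" "M *\<^sub>v x = 0\<^sub>v n"
    using det_0_iff_vec_prod_zero[OF M] by blast
  have "v \<bullet> x = 0" if v: "v \<in> set vs" for v
  proof -
    obtain i where i: "i < length vs" "v = vs ! i"
      using v by (metis in_set_conv_nth)
    then have "vs ! i \<in> carrier_vec n" using vs by auto
    then have "row M i = v"
      using i len by (simp add: M_def)
    then have "v \<bullet> x = (M *\<^sub>v x) $ i"
      using i len M by simp
    then show ?thesis using x(3) i len by simp
  qed
  with x show thesis using that by blast
qed

text \<open>
  The lists are the eigenvectors of positive and of nonpositive eigenvalues. Describing subspaces by
  the linear equations that cut them out makes the dimension count in \<open>n_plus_congruence_le\<close> a
  comparison of list lengths.
\<close>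

lemma real_symmetric_inertia:
  fixes A :: "real mat"
  assumes A: "A \<in> carrier_mat n n" and sym: "A\<^sup>T = A"
  obtains ps qs where "set ps \<subseteq> carrier_vec n" "set qs \<subseteq> carrier_vec n"
    "length ps = n_plus (map_mat complex_of_real A)" "length ps + length qs = n"
    "\<And>x. x \<in> carrier_vec n \<Longrightarrow> \<forall>u\<in>set ps. u \<bullet> x = 0 \<Longrightarrow> x \<bullet> (A *\<^sub>v x) \<le> 0"
    "\<And>x. x \<in> carrier_vec n \<Longrightarrow> x \<noteq> 0\<^sub>v n \<Longrightarrow> \<forall>u\<in>set qs. u \<bullet> x = 0 \<Longrightarrow> x \<bullet> (A *\<^sub>v x) > 0"
proof -
  obtain U d where U: "U \<in> carrier_mat n n" and UU: "U\<^sup>T * U = 1\<^sub>m n"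
    and UAU: "U\<^sup>T * A * U = Matrix.mat n n (\<lambda>(i, j). if i = j then d i else 0)"
    using real_symmetric_diagonalization[OF A sym] by blast
  let ?D = "Matrix.mat n n (\<lambda>(i, j). if i = j then d i else 0)"
  have UT: "U\<^sup>T \<in> carrier_mat n n" using U by simp
  have UU': "U * U\<^sup>T = 1\<^sub>m n"
    by (rule mat_mult_left_right_inverse[OF UT U UU])
  have D: "?D \<in> carrier_mat n n" by simp
  have "U * ?D * U\<^sup>T = (U * U\<^sup>T) * A * (U * U\<^sup>T)"
    unfolding UAU[symmetric] using A U UT
    by (simp add: assoc_mult_mat[of _ n n _ n _ n])
  then have AD: "A = U * ?D * U\<^sup>T"
    unfolding UU' using A by simp
  have "similar_mat A ?D"
    unfolding similar_mat_def
    by (intro exI, rule similar_mat_witI[OF UU' UU AD A D U UT])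
  then have np: "n_plus (map_mat complex_of_real A) = length (filter (\<lambda>i. d i > 0) [0..<n])"
    by (simp only: n_plus_of_real_similar n_plus_diagonal)
  define ps where "ps = map (col U) (filter (\<lambda>i. d i > 0) [0..<n])"
  define qs where "qs = map (col U) (filter (\<lambda>i. \<not> d i > 0) [0..<n])"
  \<comment> \<open>In the coordinates \<open>U\<^sup>T *\<^sub>v x\<close> the quadratic form is
    diagonal, so the signs of \<open>d\<close> control its sign.\<close>
  have quad: "x \<bullet> (A *\<^sub>v x) = (\<Sum>i<n. d i * (col U i \<bullet> x)\<^sup>2)" if x: "x \<in> carrier_vec n" for x
  proof -
    define y where "y = U\<^sup>T *\<^sub>v x"
    have y: "y \<in> carrier_vec n" using x UT by (simp add: y_def)
    have "x \<bullet> (A *\<^sub>v x) = x \<bullet> (U *\<^sub>v (?D *\<^sub>v y))"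
      unfolding y_def using x U UT D by (simp add: AD assoc_mult_mat_vec[of _ n n _ n])
    also have "\<dots> = y \<bullet> (?D *\<^sub>v y)"
      unfolding y_def
      by (rule transpose_vec_mult_scalar[OF U mult_mat_vec_carrier[OF D y, unfolded y_def] x, symmetric])
    also have "\<dots> = (\<Sum>i<n. y $ i * (\<Sum>j<n. (if i = j then d i else 0) * y $ j))"
      using y by (simp add: scalar_prod_def atLeast0LessThan)
    also have "\<dots> = (\<Sum>i<n. d i * (y $ i)\<^sup>2)"
      by (intro sum.cong refl) (simp add: if_distrib[of "\<lambda>c. c * _"] power2_eq_square cong: if_cong)
    finally show ?thesis
      using U by (simp add: y_def)
  qed
  show thesis
  proof
    show "set ps \<subseteq> carrier_vec n" "set qs \<subseteq> carrier_vec n"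
      using U by (auto simp: ps_def qs_def)
    show "length ps = n_plus (map_mat complex_of_real A)"
      by (simp add: ps_def np)
    show "length ps + length qs = n"
      using sum_length_filter_compl[of "\<lambda>i. d i > 0" "[0..<n]"] by (simp add: ps_def qs_def)
  next
    fix x assume x: "x \<in> carrier_vec n" and "\<forall>u\<in>set ps. u \<bullet> x = 0"
    then have "d i > 0 \<Longrightarrow> col U i \<bullet> x = 0" if "i < n" for i
      using that by (auto simp: ps_def)
    then have "d i * (col U i \<bullet> x)\<^sup>2 \<le> 0" if "i < n" for i
      using that by (cases "d i > 0") (auto simp: mult_nonpos_nonneg)
    then show "x \<bullet> (A *\<^sub>v x) \<le> 0"
      unfolding quad[OF x] by (intro sum_nonpos) auto
  next
    fix x assume x: "x \<in> carrier_vec n" "x \<noteq> 0\<^sub>v n" and "\<forall>u\<in>set qs. u \<bullet> x = 0"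
    then have 0: "col U i \<bullet> x = 0" if "i < n" "\<not> d i > 0" for i
      using that by (auto simp: qs_def)
    \<comment> \<open>If all coordinates vanished, \<open>x\<close> would equal
      \<open>U * U\<^sup>T\<close> applied to \<open>x\<close>, hence 0.\<close>
    have "\<exists>i<n. col U i \<bullet> x \<noteq> 0"
    proof (rule ccontr)
      assume "\<not> ?thesis"
      then have "U\<^sup>T *\<^sub>v x = 0\<^sub>v n" using U by (intro eq_vecI) auto
      moreover have "U *\<^sub>v 0\<^sub>v n = 0\<^sub>v n" using U by (intro eq_vecI) auto
      ultimately have "(U * U\<^sup>T) *\<^sub>v x = 0\<^sub>v n" using U UT x(1) by (simp add: assoc_mult_mat_vec[of _ n n _ n])
      then show False using x by (simp add: UU')
    qed
    then obtain i where i: "i < n" "col U i \<bullet> x \<noteq> 0" by blast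
    show "x \<bullet> (A *\<^sub>v x) > 0"
      unfolding quad[OF x(1)]
    proof (rule sum_pos2[of _ i])
      show "d i * (col U i \<bullet> x)\<^sup>2 > 0" using i 0[OF i(1)] by (cases "d i > 0") auto
      show "d j * (col U j \<bullet> x)\<^sup>2 \<ge> 0" if "j \<in> {..<n}" for j
        using that 0[of j] by (cases "d j > 0") auto
    qed (use i in auto)
  qed
qed

text \<open>If the inequality failed, a subspace on which the new form is positive and the preimage
  under \<open>S\<close> of one on which \<open>A\<close> is nonpositive would together be cut out
  by fewer than \<open>m\<close> equations. A common nonzero vector then gives a contradiction.
  \<open>S\<close> may be rectangular or singular.\<close>

lemma n_plus_congruence_le:
  fixes A S :: "real mat"
  assumes A: "A \<in> carrier_mat n n" and sym: "A\<^sup>T = A" and S: "S \<in> carrier_mat n m"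
  shows "n_plus (map_mat complex_of_real (S\<^sup>T * A * S)) \<le> n_plus (map_mat complex_of_real A)"
proof (rule ccontr)
  assume less: "\<not> ?thesis"
  define B where "B = S\<^sup>T * A * S"
  have B: "B \<in> carrier_mat m m" using A S by (simp add: B_def)
  have symB: "B\<^sup>T = B"
    unfolding B_def using A S sym by (simp add: transpose_mult[of _ m n _ m] transpose_mult[of _ n n _ m])
  obtain ps where ps: "set ps \<subseteq> carrier_vec n" "length ps = n_plus (map_mat complex_of_real A)"
    and neg: "\<And>x. x \<in> carrier_vec n \<Longrightarrow> \<forall>u\<in>set ps. u \<bullet> x = 0 \<Longrightarrow> x \<bullet> (A *\<^sub>v x) \<le> 0"
    using real_symmetric_inertia[OF A sym] by metis
  obtain qs where qs: "set qs \<subseteq> carrier_vec m"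
    "n_plus (map_mat complex_of_real B) + length qs = m"
    and pos: "\<And>x. x \<in> carrier_vec m \<Longrightarrow> x \<noteq> 0\<^sub>v m \<Longrightarrow> \<forall>u\<in>set qs. u \<bullet> x = 0 \<Longrightarrow> x \<bullet> (B *\<^sub>v x) > 0"
    using real_symmetric_inertia[OF B symB] by metis
  \<comment> \<open>Pairing \<open>S\<^sup>T *\<^sub>v u\<close> with \<open>x\<close> is pairing
    \<open>u\<close> with \<open>S *\<^sub>v x\<close>, so the first part of the list states the
    conditions on \<open>S *\<^sub>v x\<close> as equations for \<open>x\<close>.\<close>
  let ?vs = "map (\<lambda>u. S\<^sup>T *\<^sub>v u) ps @ qs"
  have "set ?vs \<subseteq> carrier_vec m" "length ?vs < m"
    using less ps qs S by (auto simp: B_def)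
  then obtain x where x: "x \<in> carrier_vec m" "x \<noteq> 0\<^sub>v m" and orth: "\<And>v. v \<in> set ?vs \<Longrightarrow> v \<bullet> x = 0"
    using exists_nonzero_orthogonal_vec[of ?vs m] by blast
  have Sx: "S *\<^sub>v x \<in> carrier_vec n" using S x by simp
  have "u \<bullet> (S *\<^sub>v x) = 0" if "u \<in> set ps" for u
    using orth[of "S\<^sup>T *\<^sub>v u"] that ps(1) transpose_vec_mult_scalar[OF S x(1), of u] by auto
  then have "(S *\<^sub>v x) \<bullet> (A *\<^sub>v (S *\<^sub>v x)) \<le> 0"
    by (intro neg[OF Sx]) blast
  moreover have "x \<bullet> (B *\<^sub>v x) = x \<bullet> (S\<^sup>T *\<^sub>v (A *\<^sub>v (S *\<^sub>v x)))"
    unfolding B_def using A S x(1) by (simp add: assoc_mult_mat_vec[of _ m n _ m] assoc_mult_mat_vec[of _ m n _ n] )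
  moreover have "\<dots> = (S *\<^sub>v x) \<bullet> (A *\<^sub>v (S *\<^sub>v x))"
    using transpose_vec_mult_scalar[of "S\<^sup>T" m n "A *\<^sub>v (S *\<^sub>v x)" x] A S x(1) by simp
  moreover have "x \<bullet> (B *\<^sub>v x) > 0"
    using orth by (intro pos[OF x]) auto
  ultimately show False by simp
qed

text \<open>The one-sided bound is applied to \<open>S\<close> and then to its inverse
  \<open>S'\<close>, which carries the transformed matrix back to \<open>A\<close>.\<close>

lemma n_plus_congruence:
  fixes A S S' :: "real mat"
  assumes A: "A \<in> carrier_mat n n" and sym: "A\<^sup>T = A"
    and S: "S \<in> carrier_mat n n" and S': "S' \<in> carrier_mat n n" and inv: "S * S' = 1\<^sub>m n"
  shows "n_plus (map_mat complex_of_real (S\<^sup>T * A * S)) = n_plus (map_mat complex_of_real A)"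
proof (rule antisym)
  let ?B = "S\<^sup>T * A * S"
  have B: "?B \<in> carrier_mat n n" using A S by simp
  have symB: "?B\<^sup>T = ?B"
    using A S sym by (simp add: transpose_mult[of _ n n _ n])
  have "S'\<^sup>T * S\<^sup>T = 1\<^sub>m n"
    using inv transpose_mult[OF S S'] by simp
  moreover have "S'\<^sup>T * ?B * S' = (S'\<^sup>T * S\<^sup>T) * A * (S * S')"
    using A S S' by (simp add: assoc_mult_mat[of _ n n _ n _ n])
  ultimately have "S'\<^sup>T * ?B * S' = A"
    using A inv by simp
  then show "n_plus (map_mat complex_of_real A) \<le> n_plus (map_mat complex_of_real ?B)"
    using n_plus_congruence_le[OF B symB S'] by simp
qed (rule n_plus_congruence_le[OF A sym S])

section \<open>Schur complements and updates by \<open>U * U\<^sup>T\<close>\<close>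

text \<open>
  With \<open>J = E + U U\<^sup>T\<close> and \<open>G = -1 - U\<^sup>T E\<^sup>-\<^sup>1 U\<close>, the two block diagonal matrices \<open>diag(J, -1)\<close>
  and \<open>diag(E, G)\<close> are the two Schur complement reductions of \<open>K\<close>, hence congruent.
\<close>

lemma n_plus_rank_update:
  fixes E E' U :: "real mat"
  assumes E: "E \<in> carrier_mat n n" and symE: "E\<^sup>T = E"
    and E': "E' \<in> carrier_mat n n" and symE': "E'\<^sup>T = E'" and inv: "E * E' = 1\<^sub>m n"
    and U: "U \<in> carrier_mat n m"
  shows "n_plus (map_mat complex_of_real (E + U * U\<^sup>T))
    = n_plus (map_mat complex_of_real E)
      + n_plus (map_mat complex_of_real (- 1\<^sub>m m - U\<^sup>T * E' * U))"
proof -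
  let ?O = "0\<^sub>m n m" and ?O' = "0\<^sub>m m n" and ?I = "1\<^sub>m m :: real mat"
  have UT: "U\<^sup>T \<in> carrier_mat m n" using U by simp
  define J where "J = E + U * U\<^sup>T"
  define G where "G = - ?I - U\<^sup>T * E' * U"
  have J: "J \<in> carrier_mat n n" and G: "G \<in> carrier_mat m m"
    using E E' U by (auto simp: J_def G_def)
  have inv': "E' * E = 1\<^sub>m n"
    by (rule mat_mult_left_right_inverse[OF E E' inv])
  have symJ: "J\<^sup>T = J"
    unfolding J_def using E U symE by (simp add: transpose_add[of _ n n] transpose_mult[of _ n m _ n])
  have symG: "G\<^sup>T = G"
    unfolding G_def using E' U symE'
    by (simp add: transpose_minus[of _ m m] transpose_uminus transpose_mult[of _ m n _ m] transpose_mult[of _ n n _ m])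
  define K where "K = four_block_mat E (- U) (- U\<^sup>T) (- ?I)"
  define X where "X = four_block_mat J ?O ?O' (- ?I)"
  define Y where "Y = four_block_mat E ?O ?O' G"
  have X: "X \<in> carrier_mat (n + m) (n + m)" and Y: "Y \<in> carrier_mat (n + m) (n + m)"
    unfolding X_def Y_def using J E G by auto
  have symX: "X\<^sup>T = X" and symY: "Y\<^sup>T = Y"
    unfolding X_def Y_def using J E G symJ symE symG
    by (auto simp: transpose_four_block_mat[of _ n n _ m _ m] transpose_uminus)
  \<comment> \<open>Congruence by this unipotent matrix undoes the elimination of the block
    \<open>- ?I\<close> and turns \<open>X\<close> into \<open>K\<close>. Negating the off-diagonal
    block inverts it.\<close>
  define S where "S = four_block_mat (1\<^sub>m n) ?O (U\<^sup>T) ?I"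
  define S' where "S' = four_block_mat (1\<^sub>m n) ?O (- U\<^sup>T) ?I"
  have S: "S \<in> carrier_mat (n + m) (n + m)" "S' \<in> carrier_mat (n + m) (n + m)"
    unfolding S_def S'_def by auto
  have SS': "S * S' = 1\<^sub>m (n + m)"
    unfolding S_def S'_def using UT
    by (subst mult_four_block_mat[of _ n n _ m _ m _ _ n _ m]) (auto intro!: eq_matI)
  have ST: "S\<^sup>T = four_block_mat (1\<^sub>m n) U ?O' ?I"
    unfolding S_def using U by (subst transpose_four_block_mat[of _ n n _ m _ m]) auto
  have "S\<^sup>T * X = four_block_mat J (- U) ?O' (- ?I)"
    unfolding ST X_def using J U
    by (subst mult_four_block_mat[of _ n n _ m _ m _ _ n _ m]) auto
  then have K1: "S\<^sup>T * X * S = K"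
    unfolding S_def K_def using J U UT E
    by (simp, subst mult_four_block_mat[of _ n n _ m _ m _ _ n _ m])
      (auto simp: J_def intro!: eq_matI)
  \<comment> \<open>The choice makes \<open>E * - F = - U\<close>, so that congruence by
    \<open>T\<close> turns \<open>Y\<close> into \<open>K\<close>.\<close>
  define F where "F = E' * U"
  have F: "F \<in> carrier_mat n m" using E' U by (simp add: F_def)
  have FT: "F\<^sup>T \<in> carrier_mat m n" using F by simp
  have FT_eq: "F\<^sup>T = U\<^sup>T * E'"
    unfolding F_def using E' U symE' by (simp add: transpose_mult[of _ n n _ m])
  define T where "T = four_block_mat (1\<^sub>m n) (- F) ?O' ?I"
  define T' where "T' = four_block_mat (1\<^sub>m n) F ?O' ?I"
  have T: "T \<in> carrier_mat (n + m) (n + m)" "T' \<in> carrier_mat (n + m) (n + m)"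
    unfolding T_def T'_def by auto
  have TT': "T * T' = 1\<^sub>m (n + m)"
    unfolding T_def T'_def using F
    by (subst mult_four_block_mat[of _ n n _ m _ m _ _ n _ m]) (auto intro!: eq_matI)
  have TT: "T\<^sup>T = four_block_mat (1\<^sub>m n) ?O (- F\<^sup>T) ?I"
    unfolding T_def using F
    by (subst transpose_four_block_mat[of _ n n _ m _ m]) (auto simp: transpose_uminus)
  have "F\<^sup>T * E = U\<^sup>T"
    unfolding FT_eq using E E' UT inv' by (simp add: assoc_mult_mat[of _ m n _ n _ n])
  then have "- F\<^sup>T * E = - U\<^sup>T"
    using FT E by simp
  then have "T\<^sup>T * Y = four_block_mat E ?O (- U\<^sup>T) G"
    unfolding TT Y_def using E G FT UT
    by (subst mult_four_block_mat[of _ n n _ m _ m _ _ n _ m]) auto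
  moreover have "E * - F = - U"
  proof -
    have "E * F = U"
      unfolding F_def using E E' U inv by (simp flip: assoc_mult_mat[of _ n n _ n _ m])
    then show ?thesis using E F by simp
  qed
  moreover have "- U\<^sup>T * - F + G = - ?I"
  proof -
    have "- U\<^sup>T * - F = U\<^sup>T * F" using UT F by simp
    moreover have "G = - ?I - U\<^sup>T * F"
      unfolding G_def F_def using E' U UT by (simp add: assoc_mult_mat[of _ m n _ n _ m])
    moreover have "P + (- ?I - P) = - ?I" if "P \<in> carrier_mat m m" for P
      using that by (intro eq_matI) auto
    moreover have "U\<^sup>T * F \<in> carrier_mat m m" using UT F by simp
    ultimately show ?thesis by metis
  qed
  ultimately have K2: "T\<^sup>T * Y * T = K"
    unfolding T_def K_def using E U UT G F
    by (simp, subst mult_four_block_mat[of _ n n _ m _ m _ _ n _ m]) auto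
  have map_block: "map_mat complex_of_real (four_block_mat P ?O ?O' Q)
      = four_block_mat (map_mat complex_of_real P) (0\<^sub>m n m) (0\<^sub>m m n) (map_mat complex_of_real Q)"
    if "P \<in> carrier_mat n n" "Q \<in> carrier_mat m m" for P Q
    using that by (subst map_four_block_mat[of _ n n _ m _ m]) auto
  \<comment> \<open>The block \<open>- ?I\<close> has no positive eigenvalue, so \<open>X\<close>
    contributes exactly the count of \<open>J\<close>.\<close>
  have "- ?I = Matrix.mat m m (\<lambda>(i, j). if i = j then - 1 else 0)"
    by (rule eq_matI) auto
  then have "n_plus (map_mat complex_of_real (- ?I)) = 0"
    using n_plus_diagonal[of m "\<lambda>_. - 1"] by simp
  moreover have "n_plus (map_mat complex_of_real X) = n_plus (map_mat complex_of_real Y)"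
    using n_plus_congruence[OF X symX S SS'] n_plus_congruence[OF Y symY T TT'] by (simp add: K1 K2)
  ultimately show ?thesis
    unfolding X_def Y_def using J E G
    by (simp add: map_block n_plus_four_block_diag[of _ n _ m] J_def G_def)
qed

section \<open>Diagonal matrices and their inverses\<close>

lemma diagonal_mat_mult:
  fixes d e :: "nat \<Rightarrow> 'a :: semiring_0"
  shows "Matrix.mat n n (\<lambda>(i, j). if i = j then d i else 0) * Matrix.mat n n (\<lambda>(i, j). if i = j then e i else 0)
    = Matrix.mat n n (\<lambda>(i, j). if i = j then d i * e i else 0)"
proof (rule eq_matI)
  fix i j assume "i < dim_row (Matrix.mat n n (\<lambda>(i, j). if i = j then d i * e i else 0))"
    "j < dim_col (Matrix.mat n n (\<lambda>(i, j). if i = j then d i * e i else 0))"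
  then have "i < n" "j < n" by auto
  then show "(Matrix.mat n n (\<lambda>(i, j). if i = j then d i else 0) * Matrix.mat n n (\<lambda>(i, j). if i = j then e i else 0)) $$ (i, j)
    = Matrix.mat n n (\<lambda>(i, j). if i = j then d i * e i else 0) $$ (i, j)"
    by (auto simp: scalar_prod_def if_distrib[of "\<lambda>c. c * _"] cong: if_cong)
qed auto

lemma scalar_prod_diagonal:
  fixes d :: "nat \<Rightarrow> 'a :: semiring_0"
  assumes "x \<in> carrier_vec n" "y \<in> carrier_vec n"
  shows "x \<bullet> (Matrix.mat n n (\<lambda>(i, j). if i = j then d i else 0) *\<^sub>v y) = (\<Sum>i<n. x $ i * (d i * y $ i))"
  using assms
  by (auto simp: scalar_prod_def atLeast0LessThan if_distrib[of "\<lambda>c. c * _"] cong: if_cong intro!: sum.cong)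

text \<open>A zero on the diagonal would give a zero row in the product with an inverse. Membership
  in \<open>Units\<close> excludes the value \<open>None\<close> of \<open>mat_inverse\<close>, and
  uniqueness of inverses identifies its result.\<close>

lemma mat_inverse_diagonal:
  fixes d :: "nat \<Rightarrow> 'a :: field"
  assumes inv: "invertible_mat (Matrix.mat n n (\<lambda>(i, j). if i = j then d i else 0))" (is "invertible_mat ?D")
  shows "\<forall>i<n. d i \<noteq> 0"
    and "the (mat_inverse ?D) = Matrix.mat n n (\<lambda>(i, j). if i = j then 1 / d i else 0)" (is "_ = ?E")
proof -
  have D: "?D \<in> carrier_mat n n" and E: "?E \<in> carrier_mat n n" by simp_all
  obtain B where B: "?D * B = 1\<^sub>m n" "B * ?D = 1\<^sub>m (dim_row B)"
    using inv by (auto simp: invertible_mat_def inverts_mat_def)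
  \<comment> \<open>\<open>invertible_mat\<close> does not fix the dimensions of the inverse; the
    column numbers of the two products recover them.\<close>
  have dB: "dim_row B = n" "dim_col B = n"
    using arg_cong[OF B(2), of dim_col] arg_cong[OF B(1), of dim_col] by simp_all
  show nz: "\<forall>i<n. d i \<noteq> 0"
  proof (intro allI impI notI)
    fix i assume i: "i < n" "d i = 0"
    then have "(?D * B) $$ (i, i) = 0"
      using dB by (auto simp: scalar_prod_def intro!: sum.neutral)
    then show False using i B(1) by simp
  qed
  have DE: "?D * ?E = 1\<^sub>m n"
    unfolding diagonal_mat_mult using nz by (intro eq_matI) auto
  have "?D \<in> Units (ring_mat TYPE('a) n ())"
    using D E DE mat_mult_left_right_inverse[OF D E DE]
    unfolding Units_def ring_mat_def by auto
  then obtain C where C: "mat_inverse ?D = Some C"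
    using mat_inverse(1)[OF D, where b = "()"] by (cases "mat_inverse ?D") auto
  then have "C * ?D = 1\<^sub>m n" "C \<in> carrier_mat n n"
    using mat_inverse(2)[OF D] by auto
  then have "C = ?E"
    using assoc_mult_mat[of C n n ?D n ?E n] D E DE by simp
  then show "the (mat_inverse ?D) = ?E" using C by simp
qed

section \<open>The Kuramoto Jacobian in rotated coordinates\<close>

text \<open>Shifting all angles by \<open>a\<close> turns the sum R exp(i \<phi>) of the unit
  vectors into R exp(i (\<phi> - a)). The identities are its real part at each angle of
  \<open>\<theta>\<close> and both its parts at \<open>a = \<phi>\<close>.\<close>

lemma cos_sin_sums_polar:
  fixes \<theta> :: "real Matrix.vec"
  obtains R \<phi> where
    "\<And>i. (\<Sum>k<dim_vec \<theta>. cos (\<theta> $ k - \<theta> $ i)) = R * cos (\<theta> $ i - \<phi>)"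
    "(\<Sum>k<dim_vec \<theta>. cos (\<theta> $ k - \<phi>)) = R" "(\<Sum>k<dim_vec \<theta>. sin (\<theta> $ k - \<phi>)) = 0"
proof -
  obtain R \<phi> where R: "(\<Sum>k<dim_vec \<theta>. cos (\<theta> $ k)) = R * cos \<phi>" "(\<Sum>k<dim_vec \<theta>. sin (\<theta> $ k)) = R * sin \<phi>"
    using polar_Ex[of "\<Sum>k<dim_vec \<theta>. cos (\<theta> $ k)" "\<Sum>k<dim_vec \<theta>. sin (\<theta> $ k)"] by blast
  have c: "(\<Sum>k<dim_vec \<theta>. cos (\<theta> $ k - a)) = R * cos (a - \<phi>)" for a
    by (simp add: cos_diff sum.distrib flip: sum_distrib_right) (simp add: R algebra_simps)
  have s: "(\<Sum>k<dim_vec \<theta>. sin (\<theta> $ k - a)) = R * sin (\<phi> - a)" for a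
    by (simp add: sin_diff sum_subtractf flip: sum_distrib_right) (simp add: R algebra_simps)
  show thesis
    by (rule that[OF c]) (simp_all add: c s)
qed

theorem theorem2p2:
  fixes N :: nat and \<theta> :: "real Matrix.vec"
  assumes "N \<ge> 1"
    and "\<theta> \<in> carrier_vec N"
    and "invertible_mat (kuramoto_diag \<theta>)"
  shows "kuramoto_tau \<theta>
           = sin_vec \<theta> \<bullet> (the (mat_inverse (kuramoto_diag \<theta>)) *\<^sub>v sin_vec \<theta>)
             + cos_vec \<theta> \<bullet> (the (mat_inverse (kuramoto_diag \<theta>)) *\<^sub>v cos_vec \<theta>)
       \<and> kuramoto_tau \<theta>
           = ones_vec N \<bullet> (the (mat_inverse (kuramoto_diag \<theta>)) *\<^sub>v ones_vec N)
       \<and> (kuramoto_tau \<theta> < 2 \<longrightarrow>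
            n_plus (map_mat complex_of_real (kuramoto_jacobian \<theta>))
              = n_plus (map_mat complex_of_real (- kuramoto_diag \<theta>)))
       \<and> (kuramoto_tau \<theta> > 2 \<longrightarrow>
            n_plus (map_mat complex_of_real (kuramoto_jacobian \<theta>))
              = n_plus (map_mat complex_of_real (- kuramoto_diag \<theta>)) + 1)"
proof -
  define d where "d i = (\<Sum>k<N. cos (\<theta> $ k - \<theta> $ i))" for i
  have N: "dim_vec \<theta> = N" using assms(2) by simp
  let ?D = "Matrix.mat N N (\<lambda>(i, j). if i = j then d i else 0)"
  have D: "kuramoto_diag \<theta> = ?D"
    unfolding kuramoto_diag_def N d_def ..
  have d0: "d i \<noteq> 0" if "i < N" for i
    using mat_inverse_diagonal(1)[of N d] assms(3) that unfolding D by blast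
  have inv: "the (mat_inverse ?D) = Matrix.mat N N (\<lambda>(i, j). if i = j then 1 / d i else 0)"
    using mat_inverse_diagonal(2)[of N d] assms(3) unfolding D by blast
  have tau: "kuramoto_tau \<theta> = (\<Sum>i<N. 1 / d i)"
    by (simp add: kuramoto_tau_def N d_def)
  have part1: "kuramoto_tau \<theta> = sin_vec \<theta> \<bullet> (the (mat_inverse ?D) *\<^sub>v sin_vec \<theta>)
      + cos_vec \<theta> \<bullet> (the (mat_inverse ?D) *\<^sub>v cos_vec \<theta>)"
  proof -
    have carr: "sin_vec \<theta> \<in> carrier_vec N" "cos_vec \<theta> \<in> carrier_vec N"
      using assms(2) by (simp_all add: sin_vec_def cos_vec_def)
    have s: "sin_vec \<theta> \<bullet> (the (mat_inverse ?D) *\<^sub>v sin_vec \<theta>) = (\<Sum>i<N. sin (\<theta> $ i) * (1 / d i * sin (\<theta> $ i)))"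
      unfolding inv scalar_prod_diagonal[OF carr(1) carr(1)]
      by (intro sum.cong refl) (simp add: sin_vec_def N)
    have c: "cos_vec \<theta> \<bullet> (the (mat_inverse ?D) *\<^sub>v cos_vec \<theta>) = (\<Sum>i<N. cos (\<theta> $ i) * (1 / d i * cos (\<theta> $ i)))"
      unfolding inv scalar_prod_diagonal[OF carr(2) carr(2)]
      by (intro sum.cong refl) (simp add: cos_vec_def N)
    have "sin x * (1 / y * sin x) + cos x * (1 / y * cos x) = 1 / y" for x y :: real
    proof -
      have "sin x * (1 / y * sin x) + cos x * (1 / y * cos x) = cos x * cos x / y + sin x * sin x / y"
        by simp
      also have "\<dots> = (cos x * cos x + sin x * sin x) / y"
        by (rule add_divide_distrib[symmetric])
      finally show ?thesis by (simp only: sin_cos_squared_add3)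
    qed
    then show ?thesis
      unfolding s c tau sum.distrib[symmetric] by simp
  qed
  have part2: "kuramoto_tau \<theta> = ones_vec N \<bullet> (the (mat_inverse ?D) *\<^sub>v ones_vec N)"
    unfolding inv tau by (simp add: scalar_prod_diagonal[of _ N] ones_vec_def)
  obtain R \<phi> where polar: "\<And>i. d i = R * cos (\<theta> $ i - \<phi>)"
    and sumc: "(\<Sum>k<N. cos (\<theta> $ k - \<phi>)) = R" and sums: "(\<Sum>k<N. sin (\<theta> $ k - \<phi>)) = 0"
    using cos_sin_sums_polar[of \<theta>] unfolding N d_def by metis
  \<comment> \<open>Index 0 exists because \<open>N\<close> is positive, and \<open>R = 0\<close>
    would make \<open>d 0\<close> vanish.\<close>
  have R: "R \<noteq> 0"
    using polar[of 0] d0[of 0] assms(1) by auto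
  \<comment> \<open>Rotating the angles by \<phi> leaves \<open>U * U\<^sup>T\<close> the same as
    for the columns \<open>cos_vec \<theta>\<close> and \<open>sin_vec \<theta>\<close>, but makes
    \<open>U\<^sup>T * E' * U\<close> diagonal.\<close>
  define U where "U = Matrix.mat N 2 (\<lambda>(i, j). if j = 0 then cos (\<theta> $ i - \<phi>) else sin (\<theta> $ i - \<phi>))"
  define E' where "E' = Matrix.mat N N (\<lambda>(i, j). if i = j then - (1 / d i) else 0)"
  have U: "U \<in> carrier_mat N 2" and E': "E' \<in> carrier_mat N N" and E: "- ?D \<in> carrier_mat N N"
    by (auto simp: U_def E'_def)
  have negD: "- ?D = Matrix.mat N N (\<lambda>(i, j). if i = j then - d i else 0)"
    by (rule eq_matI) auto
  have symE: "(- ?D)\<^sup>T = - ?D" and symE': "E'\<^sup>T = E'"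
    by (auto simp: E'_def intro!: eq_matI)
  have EE': "- ?D * E' = 1\<^sub>m N"
    unfolding negD E'_def diagonal_mat_mult using d0 by (intro eq_matI) auto
  have J: "kuramoto_jacobian \<theta> = - ?D + U * U\<^sup>T"
  proof (rule eq_matI)
    fix i j assume "i < dim_row (- ?D + U * U\<^sup>T)" "j < dim_col (- ?D + U * U\<^sup>T)"
    then have ij: "i < N" "j < N" using U by auto
    have "(U * U\<^sup>T) $$ (i, j)
        = cos (\<theta> $ i - \<phi>) * cos (\<theta> $ j - \<phi>) + sin (\<theta> $ i - \<phi>) * sin (\<theta> $ j - \<phi>)"
      using ij by (simp add: U_def scalar_prod_def numeral_2_eq_2)
    also have "\<dots> = cos (\<theta> $ i - \<theta> $ j)"
      by (simp flip: cos_diff)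
    finally have UU: "(U * U\<^sup>T) $$ (i, j) = cos (\<theta> $ i - \<theta> $ j)" .
    \<comment> \<open>The summand \<open>k = i\<close>, present in \<open>d i\<close> but absent
      from the Jacobian's diagonal, is supplied by the diagonal entry cos 0 = 1 of
      \<open>U * U\<^sup>T\<close>.\<close>
    have "d i = 1 + (\<Sum>k\<in>{..<N} - {i}. cos (\<theta> $ k - \<theta> $ i))"
      unfolding d_def using ij by (subst sum.remove[of _ i]) auto
    moreover have "(- ?D + U * U\<^sup>T) $$ (i, j) = (if i = j then - d i else 0) + cos (\<theta> $ i - \<theta> $ j)"
      using ij U UU by (simp del: index_mult_mat(1))
    ultimately show "kuramoto_jacobian \<theta> $$ (i, j) = (- ?D + U * U\<^sup>T) $$ (i, j)"
      using ij N by (auto simp: kuramoto_jacobian_index)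
  qed (use U N in \<open>auto simp: kuramoto_jacobian_def\<close>)
  have G: "- 1\<^sub>m 2 - U\<^sup>T * E' * U
      = Matrix.mat 2 2 (\<lambda>(i, j). if i = j then if i = 0 then 0 else kuramoto_tau \<theta> - 2 else 0)" (is "?G = ?H")
  proof (rule eq_matI)
    fix i j assume "i < dim_row ?H" "j < dim_col ?H"
    then have ij: "i < 2" "j < 2" by auto
    let ?u = "\<lambda>j k. if j = 0 then cos (\<theta> $ k - \<phi>) else sin (\<theta> $ k - \<phi>)"
    have "U\<^sup>T * E' * U = U\<^sup>T * (E' * U)"
      using U E' by simp
    then have "(U\<^sup>T * E' * U) $$ (i, j) = col U i \<bullet> (E' *\<^sub>v col U j)"
      using U E' ij by (simp add: mult_mat_vec_def)
    also have "\<dots> = - (\<Sum>k<N. ?u i k * ?u j k / d k)"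
      unfolding E'_def using U ij
      by (subst scalar_prod_diagonal[of _ N]) (auto simp: U_def sum_negf[symmetric] intro!: sum.cong)
    finally have entry: "?G $$ (i, j) = (\<Sum>k<N. ?u i k * ?u j k / d k) - (if i = j then 1 else 0)"
      using ij U E' by simp
    \<comment> \<open>As this ratio does not depend on \<open>k\<close>, every entry involving the
      cosine column reduces to \<open>sumc\<close> or \<open>sums\<close>.\<close>
    have c: "cos (\<theta> $ k - \<phi>) / d k = 1 / R" if "k < N" for k
      using d0[OF that] polar[of k] R by simp
    have cc: "(\<Sum>k<N. cos (\<theta> $ k - \<phi>) * cos (\<theta> $ k - \<phi>) / d k) = 1"
    proof -
      have "(\<Sum>k<N. cos (\<theta> $ k - \<phi>) * cos (\<theta> $ k - \<phi>) / d k) = (\<Sum>k<N. cos (\<theta> $ k - \<phi>) * (1 / R))"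
        by (intro sum.cong refl) (simp only: lessThan_iff c times_divide_eq_right[symmetric])
      then show ?thesis using sumc R by (simp flip: sum_divide_distrib)
    qed
    have sc: "(\<Sum>k<N. sin (\<theta> $ k - \<phi>) * cos (\<theta> $ k - \<phi>) / d k) = 0"
    proof -
      have "(\<Sum>k<N. sin (\<theta> $ k - \<phi>) * cos (\<theta> $ k - \<phi>) / d k) = (\<Sum>k<N. sin (\<theta> $ k - \<phi>) * (1 / R))"
        by (intro sum.cong refl) (simp only: lessThan_iff c times_divide_eq_right[symmetric])
      then show ?thesis using sums by (simp flip: sum_divide_distrib)
    qed
    \<comment> \<open>Replacing the squared sine by 1 minus the squared cosine leaves the sum of
      \<open>1 / d k\<close>, which is tau, minus the sum in \<open>cc\<close>.\<close>
    have ss: "(\<Sum>k<N. sin (\<theta> $ k - \<phi>) * sin (\<theta> $ k - \<phi>) / d k) = kuramoto_tau \<theta> - 1"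
    proof -
      have "sin x * sin x / y = 1 / y - cos x * cos x / y" for x y :: real
        using sin_cos_squared_add3[of x]
        by (metis add_diff_cancel_left' diff_divide_distrib)
      then show ?thesis
        unfolding tau using cc by (simp only: sum_subtractf)
    qed
    have "i = 0 \<or> i = 1" "j = 0 \<or> j = 1" using ij by auto
    then show "?G $$ (i, j) = ?H $$ (i, j)"
      unfolding entry using ij cc sc ss by (auto simp: mult.commute)
  qed (use U in auto)
  \<comment> \<open>The entry 0 is never counted, so the sign of
    \<open>kuramoto_tau \<theta> - 2\<close> alone decides whether 0 or 1 is added.\<close>
  have main: "n_plus (map_mat complex_of_real (kuramoto_jacobian \<theta>))
      = n_plus (map_mat complex_of_real (- kuramoto_diag \<theta>))
        + length (filter (\<lambda>i. (if i = 0 then 0 else kuramoto_tau \<theta> - 2) > 0) [0..<2])"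
    using n_plus_rank_update[OF E symE E' symE' EE' U]
      n_plus_diagonal[of 2 "\<lambda>i. if i = 0 then 0 else kuramoto_tau \<theta> - 2"]
    unfolding D J G by simp
  show ?thesis
    unfolding main using part1 part2 D by (simp add: numeral_2_eq_2)
qed

end
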